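(* If $A\in\mathcal W$ is invertible as a bounded operator on $\ell^2$, then $A^{-1}\in\mathcal W$.
   Context: Let $\mathcal I$ be either $\mathbb N$ or $\mathbb Z$, let $\ell^2=\ell^2(\mathcal I)$ be the Hilbert space of square-summable complex sequences indexed by $\mathcal I$. Bounded linear operators on $\ell^2$ are identified with their infinite matrices with respect to the standard basis. For a complex matrix $A=(a_{ij})_{i,j\in\mathcal I}$ and $k\in\mathbb Z$ put $d_k:=\sup\{|a_{ij}|: i,j\in\mathcal I,\ i-j=k\}$ and $[\![A]\!]:=\sum_{k\in\mathbb Z}d_k$. The Wiener algebra $\mathcal W$ is the set of all infinite matrices $A=(a_{ij})_{i,j\in\mathcal I}$ with $[\![A]\!]<\infty$; every such matrix induces a bounded operator on $\ell^2$ with $\|A\|\le[\![A]\!]$. "Invertible" means bijective on $\ell^2$. *)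

theory Defs
  imports "HOL-Analysis.Analysis"
begin

text \<open>
  An index set is a set \<^term>\<open>I :: int set\<close>, either \<^term>\<open>\<nat> :: int set\<close> or
  \<^term>\<open>\<int> :: int set\<close>. A matrix over \<^term>\<open>I\<close> is a function \<^typ>\<open>int \<Rightarrow> int \<Rightarrow> complex\<close>
  of which only the entries with both indices in \<^term>\<open>I\<close> are used. A vector over \<^term>\<open>I\<close>
  is a function \<^typ>\<open>int \<Rightarrow> complex\<close> that vanishes outside \<^term>\<open>I\<close>, so that equality of
  vectors is equality of functions.
\<close>

type_synonym cvec = "int \<Rightarrow> complex"
type_synonym cmat = "int \<Rightarrow> int \<Rightarrow> complex"

definition ell2 :: "int set \<Rightarrow> cvec set" where
  "ell2 I = {x. (\<forall>i. i \<notin> I \<longrightarrow> x i = 0) \<and> (\<lambda>i. (cmod (x i))\<^sup>2) summable_on I}"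

text \<open>
  Suprema and sums are taken in \<^typ>\<open>ennreal\<close>, so that unbounded diagonals and divergent
  sums get the value \<^term>\<open>\<infinity> :: ennreal\<close>.
\<close>

definition diag_sup :: "int set \<Rightarrow> cmat \<Rightarrow> int \<Rightarrow> ennreal" where
  "diag_sup I A k = (SUP (i, j) \<in> {(i, j). i \<in> I \<and> j \<in> I \<and> i - j = k}. ennreal (cmod (A i j)))"

definition wiener_norm :: "int set \<Rightarrow> cmat \<Rightarrow> ennreal" where
  "wiener_norm I A = (\<Sum>\<^sub>\<infinity>k\<in>UNIV. diag_sup I A k)"

definition wiener :: "int set \<Rightarrow> cmat set" where
  "wiener I = {A. wiener_norm I A < \<infinity>}"

text \<open>
  For matrices in \<^term>\<open>wiener I\<close>, and more generally for matrices of bounded operators, the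
  row sums below converge absolutely for every vector in \<^term>\<open>ell2 I\<close>.
\<close>

definition mat_op :: "int set \<Rightarrow> cmat \<Rightarrow> cvec \<Rightarrow> cvec" where
  "mat_op I A x = (\<lambda>i. if i \<in> I then (\<Sum>\<^sub>\<infinity>j\<in>I. A i j * x j) else 0)"

definition invertible_on_ell2 :: "int set \<Rightarrow> cmat \<Rightarrow> bool" where
  "invertible_on_ell2 I A \<longleftrightarrow> bij_betw (mat_op I A) (ell2 I) (ell2 I)"

definition inverse_op :: "int set \<Rightarrow> cmat \<Rightarrow> cvec \<Rightarrow> cvec" where
  "inverse_op I A = inv_into (ell2 I) (mat_op I A)"

definition basis_vec :: "int \<Rightarrow> cvec" where
  "basis_vec j = (\<lambda>i. if i = j then 1 else 0)"

text \<open>The \<^term>\<open>j\<close>-th column of the matrix is the image of the \<^term>\<open>j\<close>-th basis vector.\<close>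

definition matrix_of_op :: "(cvec \<Rightarrow> cvec) \<Rightarrow> cmat" where
  "matrix_of_op T = (\<lambda>i j. T (basis_vec j) i)"

end

theory Submission
  imports Defs
begin

text \<open>
  Let \<open>A\<close> have diagonals bounded by a summable sequence \<open>d\<close>. By the bounded inverse theorem
  \<open>c * norm x \<le> norm (A x)\<close> for some \<open>c > 0\<close>. Multiply by the weight
  \<open>w l i = exp (- \<bar>i - l\<bar> / L)\<close>. The commutator of \<open>A\<close> with \<open>w l\<close> is bounded at \<open>u\<close> by
  \<open>\<Sum>m. d m * min 1 (\<bar>m\<bar> / L) * (norm (w l u) + norm (w (l - m) u))\<close>, and the sum of these
  coefficients tends to \<open>0\<close> as \<open>L\<close> grows. Hence, if \<open>A u = e j\<close>, the function
  \<open>l \<mapsto> norm (w l u)\<close> is at most a constant multiple of \<open>exp (- \<bar>l - j\<bar> / L)\<close> plus its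
  convolution with a sequence of small \<open>\<ell>\<^sup>1\<close> norm, so it is bounded by a summable function
  of \<open>l - j\<close> that does not depend on \<open>j\<close>. It dominates the entries of the \<open>j\<close>-th column of
  the inverse.
\<close>

section \<open>Operators between closed subspaces of Banach spaces\<close>

text \<open>Successive correction: solving approximately for the remaining error halves that error
  each time. The corrections are therefore dominated by a geometric series, whose sum gives the
  factor 2, and their sum stays in \<open>S\<close> because \<open>S\<close> is closed in a complete
  space.\<close>

lemma approximate_preimages_imp_preimages:
  fixes f :: "'a::banach \<Rightarrow> 'b::real_normed_vector"
  assumes f: "bounded_linear f" and S: "subspace S" "closed S" and T: "subspace T"
    and fST: "f ` S \<subseteq> T"
    and approx: "\<And>z. z \<in> T \<Longrightarrow> \<exists>x\<in>S. norm x \<le> K * norm z \<and> norm (z - f x) \<le> norm z / 2"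
    and z: "z \<in> T"
  shows "\<exists>x\<in>S. f x = z \<and> norm x \<le> 2 * K * norm z"
proof -
  interpret f: bounded_linear f by (rule f)
  obtain g where g: "\<And>z. z \<in> T \<Longrightarrow> g z \<in> S \<and> norm (g z) \<le> K * norm z \<and> norm (z - f (g z)) \<le> norm z / 2"
    using approx by metis
  \<comment> \<open>\<open>r k\<close> is the error left after \<open>k\<close> corrections and
    \<open>g (r k)\<close> is the next correction.\<close>
  define r where "r k = ((\<lambda>w. w - f (g w)) ^^ k) z" for k
  have r0: "r 0 = z" and rSuc: "r (Suc k) = r k - f (g (r k))" for k
    by (simp_all add: r_def)
  have rT: "r k \<in> T" for k
  proof (induction k)
    case (Suc k)
    then show ?case
      using g fST T unfolding rSuc by (blast intro: subspace_diff)
  qed (simp add: r0 z)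
  have rn: "norm (r k) \<le> norm z * (1/2) ^ k" for k
  proof (induction k)
    case (Suc k)
    have "norm (r (Suc k)) \<le> norm (r k) / 2"
      using g[OF rT[of k]] by (simp add: rSuc)
    with Suc show ?case by simp
  qed (simp add: r0)
  \<comment> \<open>A negative \<open>K\<close> is possible if \<open>T\<close> is trivial; then
    \<open>z\<close> and all the errors vanish, and the estimate of \<open>g (r k)\<close> still
    holds.\<close>
  have K: "0 \<le> K \<or> z = 0"
  proof (cases "z = 0")
    case False
    have "0 \<le> K * norm z"
      using g[OF z] norm_ge_zero order_trans by blast
    then show ?thesis
      using False by (simp add: zero_le_mult_iff)
  qed simp
  have gn: "norm (g (r k)) \<le> K * norm z * (1/2) ^ k" for k
  proof -
    have "norm (g (r k)) \<le> K * norm (r k)"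
      using g[OF rT] by blast
    also have "\<dots> \<le> K * (norm z * (1/2) ^ k)"
      using K rn[of k] by (auto intro: mult_left_mono)
    finally show ?thesis by (simp add: mult.assoc)
  qed
  have geo: "(\<lambda>k. K * norm z * (1/2) ^ k) sums (K * norm z * 2)"
    using sums_mult[OF geometric_sums[of "1/2::real"]] by simp
  have sn: "summable (\<lambda>k. norm (g (r k)))"
    by (rule summable_comparison_test'[OF sums_summable[OF geo], of 0]) (simp add: gn)
  then have s: "summable (\<lambda>k. g (r k))"
    by (rule summable_norm_cancel)
  let ?x = "\<Sum>k. g (r k)"
  have "?x \<in> S"
  proof (rule closed_sequentially[OF S(2)])
    show "(\<lambda>n. \<Sum>k<n. g (r k)) \<longlonglongrightarrow> ?x"
      using s by (rule summable_LIMSEQ)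
    show "(\<Sum>k<n. g (r k)) \<in> S" for n
      using g rT S(1) by (blast intro: subspace_sum)
  qed
  moreover have "f ?x = z"
  proof -
    have "(\<lambda>k. f (g (r k))) sums f ?x"
      using s by (intro f.sums summable_sums)
    moreover have "(\<lambda>k. f (g (r k))) sums (r 0 - 0)"
    proof -
      have "(\<lambda>k. norm z * (1/2) ^ k) \<longlonglongrightarrow> norm z * 0"
        by (intro tendsto_mult tendsto_const LIMSEQ_power_zero) simp
      then have "r \<longlonglongrightarrow> 0"
        using rn by (intro Lim_null_comparison[of r]) auto
      from telescope_sums'[OF this] show ?thesis
        by (simp add: rSuc)
    qed
    ultimately have "f ?x = r 0 - 0"
      by (rule sums_unique2)
    then show ?thesis
      by (simp add: r0)
  qed
  moreover have "norm ?x \<le> 2 * K * norm z"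
  proof -
    have "norm ?x \<le> (\<Sum>k. norm (g (r k)))"
      using sn by (rule summable_norm)
    also have "\<dots> \<le> (\<Sum>k. K * norm z * (1/2) ^ k)"
      by (rule suminf_le[OF gn sn sums_summable[OF geo]])
    finally show ?thesis
      using geo by (simp add: sums_iff mult_ac)
  qed
  ultimately show ?thesis by blast
qed

text \<open>The bounded inverse theorem by Baire category: \<open>T\<close> is complete and is the
  union of the sets \<open>C n\<close>, so the image of some ball of \<open>S\<close> is dense in a
  relatively open piece of \<open>T\<close>. Moving this piece to the origin and scaling yields
  approximate preimages with a linear norm bound. The lemma above makes them exact, and injectivity
  identifies them with the given vectors.\<close>

theorem bounded_below_if_bij_betw_closed_subspaces:
  fixes f :: "'a::banach \<Rightarrow> 'b::banach"
  assumes f: "bounded_linear f" and S: "subspace S" "closed S" and T: "subspace T" "closed T"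
    and bij: "bij_betw f S T"
  shows "\<exists>c>0. \<forall>x\<in>S. c * norm x \<le> norm (f x)"
proof -
  interpret f: bounded_linear f by (rule f)
  have fST: "f ` S = T" and inj: "inj_on f S"
    using bij by (auto simp: bij_betw_def)
  define C where "C n = T \<inter> closure (f ` (S \<inter> cball 0 (real n)))" for n :: nat
  have "\<exists>n. top_of_set T interior_of (C n) \<noteq> {}"
  proof (rule ccontr)
    assume "\<not> ?thesis"
    then have *: "top_of_set T interior_of (C n) = {}" for n by blast
    have "top_of_set T interior_of \<Union>(range C) = {}"
    proof (rule Baire_category_alt)
      have "completely_metrizable_space (top_of_set T)"
        using T(2) by (intro completely_metrizable_space_closedin completely_metrizable_space_euclidean) simp
      then show "completely_metrizable_space (top_of_set T) \<or>
          locally_compact_space (top_of_set T) \<and> regular_space (top_of_set T)" by blast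
      fix U assume "U \<in> range C"
      then show "closedin (top_of_set T) U \<and> top_of_set T interior_of U = {}"
        using * by (auto simp: C_def intro!: closedin_closed_Int)
    qed auto
    moreover have "\<Union>(range C) = T"
    proof (intro equalityI subsetI)
      fix y assume "y \<in> T"
      then obtain x where "x \<in> S" "y = f x" using fST by blast
      then show "y \<in> \<Union>(range C)"
        using \<open>y \<in> T\<close> real_arch_simple[of "norm x"] closure_subset by (fastforce simp: C_def)
    qed (auto simp: C_def)
    ultimately have "T = {}"
      by (metis interior_of_topspace topspace_euclidean_subtopology)
    then show False using T(1) subspace_0 by blast
  qed
  then obtain n y0 where "y0 \<in> top_of_set T interior_of (C n)" by blast
  then obtain U where U: "openin (top_of_set T) U" "y0 \<in> U" "U \<subseteq> C n"
    by (auto simp: interior_of_def)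
  then obtain r where r: "r > 0" "ball y0 r \<inter> T \<subseteq> C n"
    by (meson openin_contains_ball order_trans)
  have y0: "y0 \<in> T" using U by (auto simp: C_def)
  \<comment> \<open>A small \<open>z\<close> is the difference of \<open>y0 + z\<close> and
    \<open>y0\<close>, both in \<open>C n\<close>; subtracting approximate preimages of the two
    doubles the norm bound.\<close>
  have near: "\<exists>x\<in>S. norm x \<le> 2 * real n \<and> norm (z - f x) < e"
    if z: "z \<in> T" "norm z < r" and e: "e > 0" for z e
  proof -
    have yz: "y0 + z \<in> C n" and y: "y0 \<in> C n"
      using r z y0 T(1) by (auto simp: dist_norm subspace_add)
    have C: "\<exists>x\<in>S. norm x \<le> real n \<and> dist (f x) y < e/2" if "y \<in> C n" for y
    proof -
      have "e/2 > 0" using e by simp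
      moreover have "\<forall>d>0. \<exists>w \<in> f ` (S \<inter> cball 0 (real n)). dist w y < d"
        using that by (auto simp: C_def closure_approachable)
      ultimately obtain w where w: "w \<in> f ` (S \<inter> cball 0 (real n))" "dist w y < e/2"
        by blast
      then show ?thesis by auto
    qed
    obtain x1 where x1: "x1 \<in> S" "norm x1 \<le> real n" "dist (f x1) (y0 + z) < e/2"
      using C[OF yz] by blast
    obtain x2 where x2: "x2 \<in> S" "norm x2 \<le> real n" "dist (f x2) y0 < e/2"
      using C[OF y] by blast
    show ?thesis
    proof (intro bexI conjI)
      show "x1 - x2 \<in> S" using x1 x2 S(1) by (simp add: subspace_diff)
      show "norm (x1 - x2) \<le> 2 * real n"
        using x1 x2 norm_triangle_ineq4[of x1 x2] by linarith
      have "z - f (x1 - x2) = (y0 + z - f x1) - (y0 - f x2)"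
        by (simp add: f.diff)
      then have "norm (z - f (x1 - x2)) \<le> norm (y0 + z - f x1) + norm (y0 - f x2)"
        by (simp only: norm_triangle_ineq4)
      moreover have "norm (y0 + z - f x1) < e/2" "norm (y0 - f x2) < e/2"
        using x1(3) x2(3) by (simp_all only: dist_norm norm_minus_commute[of "f x1"] norm_minus_commute[of "f x2"])
      ultimately show "norm (z - f (x1 - x2)) < e" by linarith
    qed
  qed
  \<comment> \<open>A nonzero \<open>z\<close> is scaled to norm \<open>r / 2\<close>, and scaling
    back multiplies the bound \<open>2 * n\<close> by \<open>2 * norm z / r\<close>. Using
    \<open>n + 1\<close> in place of \<open>n\<close> keeps \<open>K\<close> positive.\<close>
  define K where "K = 4 * (real n + 1) / r"
  have K: "K > 0" using r by (simp add: K_def)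
  have "\<exists>x\<in>S. norm x \<le> K * norm z \<and> norm (z - f x) \<le> norm z / 2" if z: "z \<in> T" for z
  proof (cases "z = 0")
    case True
    then show ?thesis using S(1) subspace_0 by (intro bexI[of _ 0]) (auto simp: f.zero)
  next
    case False
    define t where "t = r / (2 * norm z)"
    have t: "t > 0" "norm (t *\<^sub>R z) < r" using False r by (auto simp: t_def)
    obtain x where x: "x \<in> S" "norm x \<le> 2 * real n" "norm (t *\<^sub>R z - f x) < t * norm z / 2"
      using near[of "t *\<^sub>R z" "t * norm z / 2"] t z T(1) False by (auto simp: subspace_scale)
    show ?thesis
    proof (intro bexI conjI)
      show "(1/t) *\<^sub>R x \<in> S" using x S(1) by (simp add: subspace_scale)
      have "norm ((1/t) *\<^sub>R x) \<le> (1/t) * (2 * (real n + 1))"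
        using t x by (simp add: divide_right_mono)
      also have "\<dots> = K * norm z"
        using r False by (simp add: K_def t_def field_simps)
      finally show "norm ((1/t) *\<^sub>R x) \<le> K * norm z" .
      have "z - f ((1/t) *\<^sub>R x) = (1/t) *\<^sub>R (t *\<^sub>R z - f x)"
        using t by (simp add: f.scaleR algebra_simps)
      then have "norm (z - f ((1/t) *\<^sub>R x)) = norm (t *\<^sub>R z - f x) / t"
        using t by simp
      also have "\<dots> \<le> norm z / 2"
        using x t by (simp add: field_simps)
      finally show "norm (z - f ((1/t) *\<^sub>R x)) \<le> norm z / 2" .
    qed
  qed
  then have pre: "\<exists>x\<in>S. f x = z \<and> norm x \<le> 2 * K * norm z" if "z \<in> T" for z
    using approximate_preimages_imp_preimages[OF f S T(1)] fST that by blast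
  show ?thesis
  proof (intro exI conjI ballI)
    show "1 / (2 * K) > 0" using K by simp
    fix x assume x: "x \<in> S"
    then obtain x' where "x' \<in> S" "f x' = f x" "norm x' \<le> 2 * K * norm (f x)"
      using pre fST by blast
    moreover from this have "x' = x" using inj x by (meson inj_onD)
    ultimately show "1 / (2 * K) * norm x \<le> norm (f x)"
      using K by (simp add: field_simps)
  qed
qed

section \<open>The Banach space of square-summable sequences\<close>

text \<open>A single type for all index sets, so that the Banach space class applies;
  \<open>ell2 I\<close> reappears as the closed subspace of the vectors that vanish outside
  \<open>I\<close>.\<close>

typedef l2 = "ell2 UNIV" morphisms l2_nth Abs_l2
  by (rule exI[of _ "\<lambda>_. 0"]) (simp add: ell2_def)

setup_lifting type_definition_l2

lemma ell2_iff: "x \<in> ell2 I \<longleftrightarrow> (\<forall>i. i \<notin> I \<longrightarrow> x i = 0) \<and> x \<in> ell2 UNIV"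
proof -
  have "(\<lambda>i. (cmod (x i))\<^sup>2) summable_on I \<longleftrightarrow> (\<lambda>i. (cmod (x i))\<^sup>2) summable_on UNIV"
    if "\<forall>i. i \<notin> I \<longrightarrow> x i = 0"
    using that by (intro summable_on_cong_neutral) auto
  then show ?thesis by (auto simp: ell2_def)
qed

text \<open>Lets inequalities for finite square sums, such as the triangle inequality for
  \<open>L2_set\<close>, carry over to infinite ones.\<close>

lemma L2_set_bounded_imp_ell2:
  assumes "\<And>F. finite F \<Longrightarrow> L2_set (\<lambda>i. cmod (x i)) F \<le> C"
  shows "x \<in> ell2 UNIV" and "sqrt (\<Sum>\<^sub>\<infinity>i. (cmod (x i))\<^sup>2) \<le> C"
proof -
  have C: "C \<ge> 0" using assms[of "{}"] by simp
  have *: "(\<Sum>i\<in>F. (cmod (x i))\<^sup>2) \<le> C\<^sup>2" if "finite F" for F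
    using assms[OF that] C by (simp add: L2_set_def real_sqrt_le_iff' sqrt_le_D)
  have s: "(\<lambda>i. (cmod (x i))\<^sup>2) summable_on UNIV"
    by (rule nonneg_bdd_above_summable_on) (auto intro!: bdd_aboveI2[of _ _ "C\<^sup>2"] *)
  then show "x \<in> ell2 UNIV" by (simp add: ell2_def)
  have "(\<Sum>\<^sub>\<infinity>i. (cmod (x i))\<^sup>2) \<le> C\<^sup>2"
    using s * by (intro infsum_le_finite_sums) auto
  then show "sqrt (\<Sum>\<^sub>\<infinity>i. (cmod (x i))\<^sup>2) \<le> C"
    using C by (simp add: real_le_lsqrt)
qed

lemma L2_set_le_ell2_norm:
  assumes "x \<in> ell2 UNIV" "finite F"
  shows "L2_set (\<lambda>i. cmod (x i)) F \<le> sqrt (\<Sum>\<^sub>\<infinity>i. (cmod (x i))\<^sup>2)"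
  using assms unfolding L2_set_def ell2_def
  by (intro real_sqrt_le_mono finite_sum_le_infsum) auto

lemma ell2_add:
  assumes "x \<in> ell2 UNIV" "y \<in> ell2 UNIV"
  shows "(\<lambda>i. x i + y i) \<in> ell2 UNIV"
    and "sqrt (\<Sum>\<^sub>\<infinity>i. (cmod (x i + y i))\<^sup>2) \<le>
      sqrt (\<Sum>\<^sub>\<infinity>i. (cmod (x i))\<^sup>2) + sqrt (\<Sum>\<^sub>\<infinity>i. (cmod (y i))\<^sup>2)"
proof -
  have *: "L2_set (\<lambda>i. cmod (x i + y i)) F \<le>
      sqrt (\<Sum>\<^sub>\<infinity>i. (cmod (x i))\<^sup>2) + sqrt (\<Sum>\<^sub>\<infinity>i. (cmod (y i))\<^sup>2)" if F: "finite F" for F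
  proof -
    have "L2_set (\<lambda>i. cmod (x i + y i)) F \<le> L2_set (\<lambda>i. cmod (x i) + cmod (y i)) F"
      by (intro L2_set_mono norm_triangle_ineq) auto
    also have "\<dots> \<le> L2_set (\<lambda>i. cmod (x i)) F + L2_set (\<lambda>i. cmod (y i)) F"
      by (rule L2_set_triangle_ineq)
    finally show ?thesis
      using L2_set_le_ell2_norm[OF assms(1) F] L2_set_le_ell2_norm[OF assms(2) F] by linarith
  qed
  show "(\<lambda>i. x i + y i) \<in> ell2 UNIV"
    and "sqrt (\<Sum>\<^sub>\<infinity>i. (cmod (x i + y i))\<^sup>2) \<le>
      sqrt (\<Sum>\<^sub>\<infinity>i. (cmod (x i))\<^sup>2) + sqrt (\<Sum>\<^sub>\<infinity>i. (cmod (y i))\<^sup>2)"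
    using L2_set_bounded_imp_ell2[OF *] by auto
qed

lemma ell2_scale:
  assumes "x \<in> ell2 UNIV"
  shows "(\<lambda>i. c * x i) \<in> ell2 UNIV"
  using assms by (auto simp: ell2_def norm_mult power_mult_distrib intro: summable_on_cmult_right)

instantiation l2 :: real_vector
begin

lift_definition zero_l2 :: l2 is "\<lambda>_. 0"
  by (simp add: ell2_def)

lift_definition plus_l2 :: "l2 \<Rightarrow> l2 \<Rightarrow> l2" is "\<lambda>x y i. x i + y i"
  by (rule ell2_add)

lift_definition uminus_l2 :: "l2 \<Rightarrow> l2" is "\<lambda>x i. - x i"
  by (simp add: ell2_def)

lift_definition minus_l2 :: "l2 \<Rightarrow> l2 \<Rightarrow> l2" is "\<lambda>x y i. x i - y i"
  using ell2_add(1) ell2_scale[of _ "-1"] by fastforce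

lift_definition scaleR_l2 :: "real \<Rightarrow> l2 \<Rightarrow> l2" is "\<lambda>c x i. c *\<^sub>R x i"
  using ell2_scale by (simp add: scaleR_conv_of_real)

instance
proof
  fix x y z :: l2 and a b :: real
  show "x + y + z = x + (y + z)" by transfer (simp add: fun_eq_iff)
  show "x + y = y + x" by transfer (simp add: fun_eq_iff)
  show "0 + x = x" by transfer simp
  show "- x + x = 0" by transfer simp
  show "x - y = x + - y" by transfer simp
  show "a *\<^sub>R (x + y) = a *\<^sub>R x + a *\<^sub>R y" by transfer (simp add: fun_eq_iff algebra_simps)
  show "(a + b) *\<^sub>R x = a *\<^sub>R x + b *\<^sub>R x" by transfer (simp add: fun_eq_iff algebra_simps)
  show "a *\<^sub>R b *\<^sub>R x = (a * b) *\<^sub>R x" by transfer (simp add: fun_eq_iff)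
  show "1 *\<^sub>R x = x" by transfer simp
qed

end

instantiation l2 :: real_normed_vector
begin

lift_definition norm_l2 :: "l2 \<Rightarrow> real" is "\<lambda>x. sqrt (\<Sum>\<^sub>\<infinity>i. (cmod (x i))\<^sup>2)" .

definition sgn_l2 :: "l2 \<Rightarrow> l2" where "sgn_l2 x = x /\<^sub>R norm x"

definition dist_l2 :: "l2 \<Rightarrow> l2 \<Rightarrow> real" where "dist_l2 x y = norm (x - y)"

definition uniformity_l2 :: "(l2 \<times> l2) filter" where
  "uniformity_l2 = (INF e\<in>{0<..}. principal {(x, y). dist x y < e})"

definition open_l2 :: "l2 set \<Rightarrow> bool" where
  "open_l2 U = (\<forall>x\<in>U. eventually (\<lambda>(x', y). x' = x \<longrightarrow> y \<in> U) uniformity)"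

instance
proof
  fix x y :: l2 and a :: real
  show "sgn x = x /\<^sub>R norm x" by (rule sgn_l2_def)
  show "dist x y = norm (x - y)" by (rule dist_l2_def)
  show "uniformity = (INF e\<in>{0<..}. principal {(x :: l2, y). dist x y < e})"
    by (rule uniformity_l2_def)
  show "open U \<longleftrightarrow> (\<forall>x\<in>U. \<forall>\<^sub>F (x', y) in uniformity. x' = x \<longrightarrow> y \<in> U)" for U :: "l2 set"
    by (rule open_l2_def)
  show "norm x = 0 \<longleftrightarrow> x = 0"
  proof
    assume "norm x = 0"
    then have "l2_nth x i = 0" for i
      using L2_set_le_ell2_norm[OF l2_nth, of "{i}" x] by (simp add: norm_l2.rep_eq)
    then show "x = 0"
      by transfer auto
  next
    assume "x = 0"
    then show "norm x = 0" by transfer simp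
  qed
  show "norm (x + y) \<le> norm x + norm y" by transfer (rule ell2_add)
  show "norm (a *\<^sub>R x) = \<bar>a\<bar> * norm x"
    by transfer (simp add: power_mult_distrib infsum_cmult_right' real_sqrt_mult)
qed

end

lemma norm_l2_leI:
  assumes "\<And>F. finite F \<Longrightarrow> L2_set (\<lambda>i. cmod (l2_nth x i)) F \<le> C"
  shows "norm x \<le> C"
  using L2_set_bounded_imp_ell2(2)[OF assms] by (simp add: norm_l2.rep_eq)

lemma L2_set_le_norm_l2: "finite F \<Longrightarrow> L2_set (\<lambda>i. cmod (l2_nth x i)) F \<le> norm x"
  using L2_set_le_ell2_norm[OF l2_nth] by (simp add: norm_l2.rep_eq)

lemma cmod_l2_nth_le: "cmod (l2_nth x i) \<le> norm x"
  using L2_set_le_norm_l2[of "{i}" x] by simp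

lemma bounded_linear_l2_nth: "bounded_linear (\<lambda>x. l2_nth x i)"
  by (rule bounded_linear_intro[of _ 1])
    (auto simp: plus_l2.rep_eq scaleR_l2.rep_eq cmod_l2_nth_le)

instance l2 :: banach
proof
  fix X :: "nat \<Rightarrow> l2" assume X: "Cauchy X"
  define y where "y i = lim (\<lambda>n. l2_nth (X n) i)" for i
  have y: "(\<lambda>n. l2_nth (X n) i) \<longlonglongrightarrow> y i" for i
    using Cauchy_convergent[OF bounded_linear.Cauchy[OF bounded_linear_l2_nth[of i] X]]
    by (simp add: y_def convergent_LIMSEQ_iff)
  \<comment> \<open>For a fixed \<open>F\<close> the Cauchy estimate passes to the coordinatewise
    limit. Since \<open>N\<close> is chosen before \<open>F\<close>, the bound holds for the full
    norm as well.\<close>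
  have tail: "\<exists>N. \<forall>n\<ge>N. \<forall>F. finite F \<longrightarrow> L2_set (\<lambda>i. cmod (y i - l2_nth (X n) i)) F \<le> e"
    if e: "e > 0" for e
  proof -
    obtain N where N: "\<And>m n. m \<ge> N \<Longrightarrow> n \<ge> N \<Longrightarrow> norm (X m - X n) < e"
      using CauchyD[OF X e] by blast
    show ?thesis
    proof (intro exI[of _ N] allI impI)
      fix n and F :: "int set" assume n: "N \<le> n" and F: "finite F"
      have "(\<lambda>m. L2_set (\<lambda>i. cmod (l2_nth (X m) i - l2_nth (X n) i)) F)
          \<longlonglongrightarrow> L2_set (\<lambda>i. cmod (y i - l2_nth (X n) i)) F"
        unfolding L2_set_def by (intro tendsto_intros y)
      moreover have "L2_set (\<lambda>i. cmod (l2_nth (X m) i - l2_nth (X n) i)) F \<le> e" if "m \<ge> N" for m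
        using L2_set_le_norm_l2[OF F, of "X m - X n"] N[OF that n] by (simp add: minus_l2.rep_eq)
      ultimately show "L2_set (\<lambda>i. cmod (y i - l2_nth (X n) i)) F \<le> e"
        by (intro LIMSEQ_le_const2) auto
    qed
  qed
  obtain N where "\<And>F. finite F \<Longrightarrow> L2_set (\<lambda>i. cmod (y i - l2_nth (X N) i)) F \<le> 1"
    using tail[of 1] by auto
  then have "(\<lambda>i. y i - l2_nth (X N) i) \<in> ell2 UNIV"
    by (rule L2_set_bounded_imp_ell2)
  from ell2_add(1)[OF this l2_nth[of "X N"]] have "y \<in> ell2 UNIV"
    by simp
  then have Y: "l2_nth (Abs_l2 y) = y"
    by (rule Abs_l2_inverse)
  have "X \<longlonglongrightarrow> Abs_l2 y"
    unfolding LIMSEQ_iff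
  proof (intro allI impI)
    fix r :: real assume r: "r > 0"
    obtain N where N: "\<And>n F. n \<ge> N \<Longrightarrow> finite F \<Longrightarrow> L2_set (\<lambda>i. cmod (y i - l2_nth (X n) i)) F \<le> r/2"
      using tail[of "r/2"] r by auto
    have "norm (Abs_l2 y - X n) \<le> r/2" if "n \<ge> N" for n
      using N[OF that] by (intro norm_l2_leI) (simp add: minus_l2.rep_eq Y)
    then show "\<exists>N. \<forall>n\<ge>N. norm (X n - Abs_l2 y) < r"
      using r by (intro exI[of _ N]) (fastforce simp: norm_minus_commute)
  qed
  then show "convergent X" by (rule convergentI)
qed

lemma L2_set_reindex_le:
  assumes "finite F" "inj_on h F"
  shows "L2_set (\<lambda>i. cmod (l2_nth y (h i))) F \<le> norm y"
proof -
  have "L2_set (\<lambda>i. cmod (l2_nth y (h i))) F = L2_set (\<lambda>i. cmod (l2_nth y i)) (h ` F)"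
    unfolding L2_set_def by (simp add: sum.reindex[OF assms(2)])
  then show ?thesis
    using L2_set_le_norm_l2 assms(1) by simp
qed

text \<open>The common source of boundedness for a single diagonal (\<open>K = d m\<close>), for
  damping (\<open>m = 0\<close>, \<open>K = 1\<close>) and for the commutator of the two.\<close>

lemma dominated_by_shift_imp_l2:
  fixes x :: cvec
  assumes le: "\<And>i. cmod (x i) \<le> K * cmod (l2_nth y (i - m))" and K: "K \<ge> 0"
  shows "x \<in> ell2 UNIV" and "norm (Abs_l2 x) \<le> K * norm y"
proof -
  have *: "L2_set (\<lambda>i. cmod (x i)) F \<le> K * norm y" if F: "finite F" for F
  proof -
    have "L2_set (\<lambda>i. cmod (x i)) F \<le> L2_set (\<lambda>i. K * cmod (l2_nth y (i - m))) F"
      by (intro L2_set_mono le) auto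
    also have "\<dots> = K * L2_set (\<lambda>i. cmod (l2_nth y (i - m))) F"
      using K by (simp add: L2_set_right_distrib)
    also have "\<dots> \<le> K * norm y"
      using K F by (intro mult_left_mono L2_set_reindex_le) (auto simp: inj_on_def)
    finally show ?thesis .
  qed
  show x: "x \<in> ell2 UNIV"
    using L2_set_bounded_imp_ell2(1)[OF *] by blast
  show "norm (Abs_l2 x) \<le> K * norm y"
    using L2_set_bounded_imp_ell2(2)[OF *] x by (simp add: norm_l2.rep_eq Abs_l2_inverse)
qed

section \<open>Convolution inequalities and exponential weights\<close>

lemma has_sum_sum:
  fixes g :: "'k \<Rightarrow> 'a \<Rightarrow> 'b::topological_comm_monoid_add"
  assumes "\<And>k. k \<in> F \<Longrightarrow> (g k has_sum s k) A"
  shows "((\<lambda>x. \<Sum>k\<in>F. g k x) has_sum (\<Sum>k\<in>F. s k)) A"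
  using assms by (induction F rule: infinite_finite_induct) (auto intro: has_sum_add)

text \<open>\<open>G\<close> is only known to be bounded, so the convolution cannot be absorbed into
  the left-hand side at once. Instead the inequality is iterated: each use halves the contribution
  of the crude bound \<open>card F * C\<close>, while \<open>2 * infsum f UNIV\<close> is the fixed
  point of \<open>x = infsum f UNIV + x / 2\<close>.\<close>

lemma sums_bounded_if_dominated_by_convolution:
  fixes f q G :: "'a::ab_group_add \<Rightarrow> real"
  assumes f: "f summable_on UNIV" "\<And>k. 0 \<le> f k"
    and q: "q summable_on UNIV" "\<And>k. 0 \<le> q k" "infsum q UNIV \<le> 1/2"
    and G: "\<And>k. 0 \<le> G k" "\<And>k. G k \<le> C"
    and le: "\<And>k. G k \<le> f k + (\<Sum>\<^sub>\<infinity>m. q m * G (k - m))"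
    and F: "finite F"
  shows "sum G F \<le> 2 * infsum f UNIV"
proof -
  have C: "0 \<le> C" using G order_trans by blast
  have sqG: "(\<lambda>m. q m * G (k - m)) summable_on UNIV" for k
    by (rule summable_on_comparison_test[OF summable_on_cmult_left[OF q(1), of C]])
      (use q G in \<open>auto intro: mult_left_mono\<close>)
  \<comment> \<open>The induction runs over all finite sets at once, because its step passes to
    translates of \<open>F\<close>. These have the same cardinality, so the bound is the same for
    all of them.\<close>
  have *: "finite F \<Longrightarrow> sum G F \<le> 2 * infsum f UNIV + real (card F) * C * (1/2) ^ N" for F N
  proof (induction N arbitrary: F)
    case 0
    have "sum G F \<le> real (card F) * C"
      using sum_bounded_above[of F G C] G by simp
    then show ?case
      using infsum_nonneg[of UNIV f] f by simp
  next
    case (Suc N)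
    define D where "D = 2 * infsum f UNIV + real (card F) * C * (1/2) ^ N"
    have D: "0 \<le> D"
      using C infsum_nonneg[of UNIV f] f by (simp add: D_def)
    have shift: "(\<Sum>k\<in>F. G (k - m)) \<le> D" for m
    proof -
      have inj: "inj_on (\<lambda>k. k - m) F" by (auto simp: inj_on_def)
      have "(\<Sum>k\<in>F. G (k - m)) = sum G ((\<lambda>k. k - m) ` F)"
        by (simp add: sum.reindex[OF inj])
      also have "\<dots> \<le> D"
        using Suc.IH[of "(\<lambda>k. k - m) ` F"] Suc.prems by (simp add: card_image[OF inj] D_def)
      finally show ?thesis .
    qed
    have hs: "((\<lambda>m. \<Sum>k\<in>F. q m * G (k - m)) has_sum (\<Sum>k\<in>F. \<Sum>\<^sub>\<infinity>m. q m * G (k - m))) UNIV"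
      using sqG by (intro has_sum_sum has_sum_infsum)
    then have "(\<Sum>k\<in>F. \<Sum>\<^sub>\<infinity>m. q m * G (k - m)) = (\<Sum>\<^sub>\<infinity>m. \<Sum>k\<in>F. q m * G (k - m))"
      by (simp add: infsumI)
    also have "\<dots> \<le> (\<Sum>\<^sub>\<infinity>m. q m * D)"
    proof (rule infsum_mono)
      show "(\<lambda>m. \<Sum>k\<in>F. q m * G (k - m)) summable_on UNIV"
        using hs by (rule has_sum_imp_summable)
      show "(\<lambda>m. q m * D) summable_on UNIV"
        by (rule summable_on_cmult_left[OF q(1)])
      show "(\<Sum>k\<in>F. q m * G (k - m)) \<le> q m * D" for m
        using mult_left_mono[OF shift q(2)] by (simp add: sum_distrib_left)
    qed
    also have "\<dots> = infsum q UNIV * D"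
      by (rule infsum_cmult_left')
    also have "\<dots> \<le> 1/2 * D"
      using q(3) D by (rule mult_right_mono)
    finally have conv: "(\<Sum>k\<in>F. \<Sum>\<^sub>\<infinity>m. q m * G (k - m)) \<le> 1/2 * D" .
    have "sum G F \<le> sum f F + (\<Sum>k\<in>F. \<Sum>\<^sub>\<infinity>m. q m * G (k - m))"
      using sum_mono[of F G, OF le] by (simp add: sum.distrib)
    also have "\<dots> \<le> infsum f UNIV + 1/2 * D"
      using conv finite_sum_le_infsum[of f UNIV F] f Suc.prems by (intro add_mono) auto
    also have "\<dots> = 2 * infsum f UNIV + real (card F) * C * (1/2) ^ Suc N"
      by (simp add: D_def field_simps)
    finally show ?case .
  qed
  have "(\<lambda>N. 2 * infsum f UNIV + real (card F) * C * (1/2) ^ N)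
      \<longlonglongrightarrow> 2 * infsum f UNIV + real (card F) * C * 0"
    by (intro tendsto_intros LIMSEQ_power_zero) auto
  then show ?thesis
    using LIMSEQ_le_const[of _ _ "sum G F"] *[OF F] by simp
qed

text \<open>Dominated convergence by hand: a finite set carries all but \<open>e / 2\<close> of the
  sum of \<open>d\<close>. On it the linear weight is small for large \<open>L\<close>; off it the
  weight is at most 1.\<close>

lemma infsum_truncated_linear_weight_small:
  fixes d :: "int \<Rightarrow> real"
  assumes d: "d summable_on UNIV" "\<And>m. 0 \<le> d m" and e: "e > 0"
  obtains L where "L > 0" "(\<lambda>m. d m * min 1 (\<bar>real_of_int m\<bar> / L)) summable_on UNIV"
    "(\<Sum>\<^sub>\<infinity>m. d m * min 1 (\<bar>real_of_int m\<bar> / L)) \<le> e"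
proof -
  obtain F where F: "finite F" "dist (sum d F) (infsum d UNIV) \<le> e/2"
    using infsum_finite_approximation[OF d(1), of "e/2"] e by auto
  define M where "M = (\<Sum>m\<in>F. d m * \<bar>real_of_int m\<bar>)"
  have M: "M \<ge> 0" unfolding M_def using d by (intro sum_nonneg) auto
  \<comment> \<open>The first summand gives \<open>M / L \<le> e / 2\<close>; the 1 keeps
    \<open>L\<close> positive when \<open>M = 0\<close>.\<close>
  define L where "L = 2 * M / e + 1"
  have L: "L > 0" using M e by (simp add: L_def add_nonneg_pos)
  have MdL: "M / L \<le> e / 2"
    using L M e by (simp add: L_def field_simps)
  let ?g = "\<lambda>m. d m * min 1 (\<bar>real_of_int m\<bar> / L)"
  have g0: "0 \<le> ?g m" for m using d L by simp
  have gd: "?g m \<le> d m" for m using d(2)[of m] by (intro mult_left_le) auto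
  have gs: "?g summable_on UNIV"
    by (rule summable_on_comparison_test[OF d(1)]) (use g0 gd in auto)
  have "infsum ?g UNIV \<le> e"
  proof (rule infsum_le_finite_sums[OF gs])
    fix H :: "int set" assume H: "finite H"
    have "sum ?g H \<le> sum ?g (F \<union> H)"
      using F H g0 by (intro sum_mono2) auto
    also have "\<dots> = sum ?g F + sum ?g (H - F)"
      using F H by (subst sum.union_disjoint[symmetric]) auto
    also have "sum ?g F \<le> M / L"
      unfolding M_def sum_divide_distrib
      using mult_left_mono[OF min.cobounded2 d(2)] by (intro sum_mono) (simp add: times_divide_eq_right[symmetric] del: times_divide_eq_right)
    also have "sum ?g (H - F) \<le> sum d (H - F)"
      by (intro sum_mono gd)
    also have "sum d (H - F) = sum d (F \<union> H) - sum d F"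
      using F H sum.union_disjoint[of F "H - F" d] by auto
    also have "sum d (F \<union> H) \<le> infsum d UNIV"
      using F H d by (intro finite_sum_le_infsum) auto
    finally show "sum ?g H \<le> e"
      using MdL F(2) unfolding dist_real_def by linarith
  qed
  with that L gs show thesis by blast
qed

lemma summable_on_power_nat_abs:
  fixes r :: real
  assumes "0 \<le> r" "r < 1"
  shows "(\<lambda>k::int. r ^ nat \<bar>k\<bar>) summable_on UNIV"
proof -
  have s: "(\<lambda>n. r ^ n) summable_on UNIV"
    using assms by (intro summable_nonneg_imp_summable_on) (auto intro: summable_geometric)
  have "(\<lambda>k::int. r ^ nat \<bar>k\<bar>) summable_on range int"
    using s by (subst summable_on_reindex) (auto simp: o_def)
  moreover have "(\<lambda>k::int. r ^ nat \<bar>k\<bar>) summable_on range (\<lambda>n. - int n)"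
    using s by (subst summable_on_reindex) (auto simp: o_def inj_on_def)
  moreover have "range int \<union> range (\<lambda>n. - int n) = UNIV"
    by (auto simp: image_iff) (metis int_cases2)
  ultimately show ?thesis
    using summable_on_union by metis
qed

lemma summable_on_exp_abs:
  assumes "L > 0"
  shows "(\<lambda>k::int. exp (- \<bar>real_of_int k\<bar> / L)) summable_on UNIV"
proof -
  have "exp (- \<bar>real_of_int k\<bar> / L) = exp (- 1 / L) ^ nat \<bar>k\<bar>" for k
    by (simp add: exp_of_nat_mult[symmetric])
  then show ?thesis
    using summable_on_power_nat_abs[of "exp (- 1 / L)"] assms by simp
qed

text \<open>For \<open>s \<le> t\<close>, taking out \<open>exp (- s)\<close> leaves
  \<open>1 - exp (s - t)\<close>, which is at most 1 and at most \<open>t - s\<close>. The weights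
  themselves remain on the right, so that differences of weights can be bounded by damped
  vectors.\<close>

lemma abs_diff_exp_le:
  fixes s t :: real
  shows "\<bar>exp (- s) - exp (- t)\<bar> \<le> min 1 \<bar>s - t\<bar> * (exp (- s) + exp (- t))"
proof -
  have *: "exp (- s) - exp (- t) \<le> min 1 (t - s) * (exp (- s) + exp (- t))" if "s \<le> t" for s t :: real
  proof -
    have "1 - exp (s - t) \<le> min 1 (t - s)"
      using exp_ge_add_one_self[of "s - t"] exp_ge_zero[of "s - t"] by (simp only: min_def split: if_split) linarith
    then have "exp (- s) * (1 - exp (s - t)) \<le> exp (- s) * min 1 (t - s)"
      by (intro mult_left_mono) auto
    moreover have "exp (- s) * (1 - exp (s - t)) = exp (- s) - exp (- t)"
      by (simp add: right_diff_distrib exp_add[symmetric])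
    moreover have "0 \<le> min 1 (t - s) * exp (- t)"
      using that by simp
    ultimately show ?thesis by (simp add: algebra_simps)
  qed
  show ?thesis
    using *[of s t] *[of t s] by (cases "s \<le> t") (auto simp: abs_if add.commute)
qed

section \<open>Matrices dominated by a summable sequence of diagonals\<close>

lemma l2_eqI: "(\<And>i. l2_nth x i = l2_nth y i) \<Longrightarrow> x = y"
  by (metis l2_nth_inject ext)

definition diag_op :: "cmat \<Rightarrow> int \<Rightarrow> l2 \<Rightarrow> l2" where
  "diag_op a m x = Abs_l2 (\<lambda>i. a i (i - m) * l2_nth x (i - m))"

text \<open>The diagonals are summed in the norm of \<open>l2\<close>, so that boundedness and
  commutators can be estimated one diagonal at a time; the row sums are recovered in
  \<open>l2_nth_l2_op\<close>.\<close>

definition l2_op :: "cmat \<Rightarrow> l2 \<Rightarrow> l2" where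
  "l2_op a x = (\<Sum>\<^sub>\<infinity>m. diag_op a m x)"

definition damp :: "real \<Rightarrow> int \<Rightarrow> l2 \<Rightarrow> l2" where
  "damp L l x = Abs_l2 (\<lambda>i. of_real (exp (- (\<bar>of_int (i - l)\<bar> / L))) * l2_nth x i)"

context
  fixes L :: real
  assumes L: "L > 0"
begin

lemma damp_dominated:
  "cmod (of_real (exp (- (\<bar>of_int (i - l)\<bar> / L))) * l2_nth x i) \<le> 1 * cmod (l2_nth x (i - 0))"
  using L by (simp add: norm_mult mult_left_le_one_le)

lemma l2_nth_damp:
  "l2_nth (damp L l x) i = of_real (exp (- (\<bar>of_int (i - l)\<bar> / L))) * l2_nth x i"
  unfolding damp_def using dominated_by_shift_imp_l2(1)[OF damp_dominated] by (subst Abs_l2_inverse) auto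

lemma norm_damp_le: "norm (damp L l x) \<le> norm x"
  unfolding damp_def using dominated_by_shift_imp_l2(2)[OF damp_dominated] by simp

lemma bounded_linear_damp: "bounded_linear (damp L l)"
  by (rule bounded_linear_intro[of _ 1])
    (auto intro!: l2_eqI simp: l2_nth_damp plus_l2.rep_eq scaleR_l2.rep_eq algebra_simps norm_damp_le)

end

text \<open>The entries are controlled for all integer indices, so a matrix over \<open>I\<close>
  enters after extension by zero.\<close>

locale dominated_matrix =
  fixes a :: cmat and d :: "int \<Rightarrow> real"
  assumes summable_d: "d summable_on UNIV"
    and cmod_le_d: "\<And>i j. cmod (a i j) \<le> d (i - j)"
begin

lemma d_nonneg: "0 \<le> d m"
  using order_trans[OF norm_ge_zero cmod_le_d[of m 0]] by simp

lemma diag_op_dominated: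
  "cmod (a i (i - m) * l2_nth x (i - m)) \<le> d m * cmod (l2_nth x (i - m))"
  using cmod_le_d[of i "i - m"] by (simp add: norm_mult mult_right_mono)

lemma l2_nth_diag_op: "l2_nth (diag_op a m x) i = a i (i - m) * l2_nth x (i - m)"
  unfolding diag_op_def
  using dominated_by_shift_imp_l2(1)[OF diag_op_dominated d_nonneg] by (subst Abs_l2_inverse) auto

lemma norm_diag_op_le: "norm (diag_op a m x) \<le> d m * norm x"
  unfolding diag_op_def by (rule dominated_by_shift_imp_l2(2)[OF diag_op_dominated d_nonneg])

lemma has_sum_l2_op: "((\<lambda>m. diag_op a m x) has_sum l2_op a x) UNIV"
proof -
  have "(\<lambda>m. norm (diag_op a m x)) summable_on UNIV"
    by (rule summable_on_comparison_test[OF summable_on_cmult_left[OF summable_d, of "norm x"]])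
      (auto simp: norm_diag_op_le)
  then show ?thesis
    unfolding l2_op_def by (rule has_sum_infsum[OF abs_summable_summable])
qed

text \<open>Coordinates are continuous, hence commute with the sum over the diagonals; the
  substitution \<open>j = i - m\<close> then turns that sum into a row sum.\<close>

lemma l2_nth_l2_op: "l2_nth (l2_op a x) i = (\<Sum>\<^sub>\<infinity>j. a i j * l2_nth x j)"
proof -
  have "((\<lambda>m. a i (i - m) * l2_nth x (i - m)) has_sum l2_nth (l2_op a x) i) UNIV"
    using has_sum_bounded_linear[OF bounded_linear_l2_nth has_sum_l2_op] by (simp add: l2_nth_diag_op)
  moreover have "bij (\<lambda>m. i - m)"
    by (rule bij_betw_byWitness[of _ "\<lambda>m. i - m"]) auto
  ultimately show ?thesis
    using has_sum_reindex_bij_betw[of "\<lambda>m. i - m" UNIV UNIV "\<lambda>j. a i j * l2_nth x j"] infsumI by metis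
qed

lemma bounded_linear_l2_op: "bounded_linear (l2_op a)"
proof (rule bounded_linear_intro)
  fix x y :: l2 and r :: real
  have "diag_op a m (x + y) = diag_op a m x + diag_op a m y" for m
    by (rule l2_eqI) (simp add: l2_nth_diag_op plus_l2.rep_eq algebra_simps)
  then show "l2_op a (x + y) = l2_op a x + l2_op a y"
    using has_sum_unique[OF has_sum_l2_op[of "x + y"]] has_sum_add[OF has_sum_l2_op[of x] has_sum_l2_op[of y]]
    by simp
  have "diag_op a m (r *\<^sub>R x) = r *\<^sub>R diag_op a m x" for m
    by (rule l2_eqI) (simp add: l2_nth_diag_op scaleR_l2.rep_eq)
  then show "l2_op a (r *\<^sub>R x) = r *\<^sub>R l2_op a x"
    using has_sum_unique[OF has_sum_l2_op[of "r *\<^sub>R x"]] has_sum_scaleR[OF has_sum_l2_op[of x], of r]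
    by simp
  show "norm (l2_op a x) \<le> norm x * infsum d UNIV"
  proof (rule norm_infsum_le[OF has_sum_l2_op])
    show "((\<lambda>m. norm x * d m) has_sum norm x * infsum d UNIV) UNIV"
      by (intro has_sum_cmult_right has_sum_infsum summable_d)
    show "norm (diag_op a m x) \<le> norm x * d m" for m
      using norm_diag_op_le[of m x] by (simp add: mult.commute)
  qed
qed

text \<open>
  For the weight \<open>w l i = exp (- \<bar>i - l\<bar> / L)\<close> one has \<open>w l (j + m) = w (l - m) j\<close>, so that the
  commutator of \<^term>\<open>damp L l\<close> with the \<open>m\<close>-th diagonal is controlled by
  \<^term>\<open>damp L l u\<close> and \<^term>\<open>damp L (l - m) u\<close> alone.
\<close>

lemma norm_commutator_damp_diag_op_le:
  assumes L: "L > 0"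
  shows "norm (diag_op a m (damp L l u) - damp L l (diag_op a m u))
    \<le> d m * min 1 (\<bar>real_of_int m\<bar> / L) * (norm (damp L l u) + norm (damp L (l - m) u))"
proof -
  define w where "w l i = exp (- (\<bar>real_of_int (i - l)\<bar> / L))" for l i
  \<comment> \<open>The weights are nonnegative, so the moduli of the two damped copies of
    \<open>u\<close> add up without cancellation, and one vector \<open>y\<close> can dominate the
    commutator.\<close>
  define y where "y = damp L l u + damp L (l - m) u"
  define v where "v i = a i (i - m) * ((w l (i - m) - w l i) * l2_nth u (i - m))" for i
  define \<mu> where "\<mu> = min 1 (\<bar>real_of_int m\<bar> / L)"
  have \<mu>: "\<mu> \<ge> 0" using L by (simp add: \<mu>_def)
  have w0: "w l i \<ge> 0" for l i by (simp add: w_def)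
  have w: "\<bar>w l (i - m) - w l i\<bar> \<le> \<mu> * (w l (i - m) + w (l - m) (i - m))" for i
  proof -
    have "\<bar>w l (i - m) - w l i\<bar> \<le>
      min 1 \<bar>\<bar>real_of_int (i - m - l)\<bar> / L - \<bar>real_of_int (i - l)\<bar> / L\<bar> * (w l (i - m) + w l i)"
      unfolding w_def by (rule abs_diff_exp_le)
    also have "\<bar>\<bar>real_of_int (i - m - l)\<bar> / L - \<bar>real_of_int (i - l)\<bar> / L\<bar> \<le> \<bar>real_of_int m\<bar> / L"
      using L by (simp add: diff_divide_distrib[symmetric] abs_divide divide_right_mono)
    finally have "\<bar>w l (i - m) - w l i\<bar> \<le> \<mu> * (w l (i - m) + w l i)"
      using w0 unfolding \<mu>_def by (smt (verit) min.mono mult_right_mono)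
    then show ?thesis by (simp add: w_def)
  qed
  have "cmod (v i) \<le> (d m * \<mu>) * cmod (l2_nth y (i - m))" for i
  proof -
    have y: "l2_nth y (i - m) = of_real (w l (i - m) + w (l - m) (i - m)) * l2_nth u (i - m)"
      using L by (simp add: y_def plus_l2.rep_eq l2_nth_damp w_def algebra_simps)
    have ad: "cmod (a i (i - m)) \<le> d m"
      using cmod_le_d[of i "i - m"] by simp
    have "cmod (v i) = cmod (a i (i - m)) * (\<bar>w l (i - m) - w l i\<bar> * cmod (l2_nth u (i - m)))"
      by (simp add: v_def norm_mult flip: of_real_diff)
    also have "\<dots> \<le> d m * (\<mu> * (w l (i - m) + w (l - m) (i - m)) * cmod (l2_nth u (i - m)))"
      by (rule mult_mono[OF ad mult_right_mono[OF w[of i] norm_ge_zero] d_nonneg]) simp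
    also have "\<dots> = (d m * \<mu>) * cmod (l2_nth y (i - m))"
      using w0[of l "i - m"] w0[of "l - m" "i - m"]
      unfolding y norm_mult norm_of_real by (simp only: abs_of_nonneg add_nonneg_nonneg mult.assoc)
    finally show ?thesis .
  qed
  note dom = dominated_by_shift_imp_l2[OF this mult_nonneg_nonneg[OF d_nonneg \<mu>]]
  have "diag_op a m (damp L l u) - damp L l (diag_op a m u) = Abs_l2 v"
    using L by (intro l2_eqI)
      (simp add: minus_l2.rep_eq l2_nth_diag_op l2_nth_damp Abs_l2_inverse[OF dom(1)] v_def w_def algebra_simps)
  then have "norm (diag_op a m (damp L l u) - damp L l (diag_op a m u)) \<le> d m * \<mu> * norm y"
    using dom(2) by simp
  also have "\<dots> \<le> d m * \<mu> * (norm (damp L l u) + norm (damp L (l - m) u))"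
    unfolding y_def using d_nonneg \<mu> by (intro mult_left_mono norm_triangle_ineq mult_nonneg_nonneg)
  finally show ?thesis by (simp add: \<mu>_def)
qed

text \<open>Damping is continuous and passes through the sum over the diagonals, so the bounds for
  single diagonals add up. The shifted centres \<open>l - m\<close> produce a convolution in
  \<open>l\<close>.\<close>

lemma norm_commutator_damp_l2_op_le:
  assumes L: "L > 0"
    and \<epsilon>: "(\<lambda>m. d m * min 1 (\<bar>real_of_int m\<bar> / L)) summable_on UNIV" (is "?\<epsilon> summable_on _")
  shows "norm (l2_op a (damp L l u) - damp L l (l2_op a u))
    \<le> infsum ?\<epsilon> UNIV * norm (damp L l u) + (\<Sum>\<^sub>\<infinity>m. ?\<epsilon> m * norm (damp L (l - m) u))"
proof -
  have \<epsilon>0: "0 \<le> ?\<epsilon> m" for m using d_nonneg L by simp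
  have s: "(\<lambda>m. ?\<epsilon> m * norm (damp L (l - m) u)) summable_on UNIV"
    by (rule summable_on_comparison_test[OF summable_on_cmult_left[OF \<epsilon>, of "norm u"]])
      (auto intro!: mult_left_mono mult_nonneg_nonneg norm_damp_le \<epsilon>0 L simp del: min_mult_distrib_left)
  have "((\<lambda>m. damp L l (diag_op a m u)) has_sum damp L l (l2_op a u)) UNIV"
    by (rule has_sum_bounded_linear[OF bounded_linear_damp[OF L] has_sum_l2_op])
  then have "((\<lambda>m. - damp L l (diag_op a m u)) has_sum - damp L l (l2_op a u)) UNIV"
    by (simp add: has_sum_uminus)
  from has_sum_add[OF has_sum_l2_op[of "damp L l u"] this]
  have "((\<lambda>m. diag_op a m (damp L l u) - damp L l (diag_op a m u)) has_sum
      (l2_op a (damp L l u) - damp L l (l2_op a u))) UNIV"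
    by simp
  then show ?thesis
  proof (rule norm_infsum_le)
    show "((\<lambda>m. ?\<epsilon> m * norm (damp L l u) + ?\<epsilon> m * norm (damp L (l - m) u)) has_sum
      (infsum ?\<epsilon> UNIV * norm (damp L l u) + (\<Sum>\<^sub>\<infinity>m. ?\<epsilon> m * norm (damp L (l - m) u)))) UNIV"
      by (intro has_sum_add has_sum_cmult_left has_sum_infsum \<epsilon> s)
    show "norm (diag_op a m (damp L l u) - damp L l (diag_op a m u)) \<le>
        ?\<epsilon> m * norm (damp L l u) + ?\<epsilon> m * norm (damp L (l - m) u)" for m
      using norm_commutator_damp_diag_op_le[OF L, of m l u] by (simp only: distrib_left)
  qed
qed

end

text \<open>The lower bound is applied to damped columns, which is why \<open>S\<close> has to be
  stable under damping. With the commutator estimate it gives a convolution inequality for their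
  norms, uniform in the column.\<close>

lemma (in dominated_matrix) columns_of_inverse_off_diagonal_decay:
  assumes c: "c > 0"
    and S: "\<And>L l x. L > 0 \<Longrightarrow> x \<in> S \<Longrightarrow> damp L l x \<in> S"
    and below: "\<And>x. x \<in> S \<Longrightarrow> c * norm x \<le> norm (l2_op a x)"
    and b: "\<And>j. j \<in> J \<Longrightarrow> b j \<in> S" "\<And>j. j \<in> J \<Longrightarrow> l2_nth (l2_op a (b j)) = basis_vec j"
  obtains G where "G summable_on UNIV" "\<And>i j. j \<in> J \<Longrightarrow> cmod (l2_nth (b j) i) \<le> G (i - j)"
proof -
  \<comment> \<open>The value \<open>c / 4\<close> serves twice: the unshifted commutator term can
    be absorbed on the left, and the kernel \<open>q\<close>, which carries the factor
    \<open>2 / c\<close>, has sum at most 1/2.\<close>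
  obtain L where L: "L > 0"
    and \<epsilon>: "(\<lambda>m. d m * min 1 (\<bar>real_of_int m\<bar> / L)) summable_on UNIV"
    and \<epsilon>_le: "(\<Sum>\<^sub>\<infinity>m. d m * min 1 (\<bar>real_of_int m\<bar> / L)) \<le> c / 4"
    using infsum_truncated_linear_weight_small[OF summable_d d_nonneg, of "c/4"] c by auto
  define q where "q m = 2 / c * (d m * min 1 (\<bar>real_of_int m\<bar> / L))" for m
  define f where "f k = 2 / c * exp (- \<bar>real_of_int k\<bar> / L)" for k
  \<comment> \<open>\<open>k\<close> is the offset of the damping centre from the column index, and
    the supremum removes the dependence on the column. For empty \<open>J\<close> the real supremum
    has no useful value, hence the default 0.\<close>
  define G where "G k = (if J = {} then 0 else SUP j\<in>J. norm (damp L (j + k) (b j)))" for k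
  have q: "q summable_on UNIV" "0 \<le> q m" "infsum q UNIV \<le> 1/2" for m
  proof -
    show "q summable_on UNIV"
      unfolding q_def by (rule summable_on_cmult_right[OF \<epsilon>])
    show "0 \<le> q m"
      unfolding q_def using c L d_nonneg[of m] by simp
    have "infsum q UNIV = 2 / c * (\<Sum>\<^sub>\<infinity>m. d m * min 1 (\<bar>real_of_int m\<bar> / L))"
      unfolding q_def by (rule infsum_cmult_right')
    also have "\<dots> \<le> 2 / c * (c / 4)"
      using \<epsilon>_le c by (intro mult_left_mono) auto
    finally show "infsum q UNIV \<le> 1/2"
      using c by simp
  qed
  have f: "f summable_on UNIV" "0 \<le> f k" for k
  proof -
    show "f summable_on UNIV"
      unfolding f_def by (rule summable_on_cmult_right[OF summable_on_exp_abs[OF L]])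
    show "0 \<le> f k"
      unfolding f_def using c by simp
  qed
  have norm_damp_basis: "norm (damp L l (l2_op a (b j))) \<le> exp (- \<bar>real_of_int (l - j)\<bar> / L)"
    if j: "j \<in> J" for l j
  proof (rule norm_l2_leI)
    fix F :: "int set" assume F: "finite F"
    have "l2_nth (damp L l (l2_op a (b j))) i = of_real (exp (- \<bar>real_of_int (l - j)\<bar> / L)) * (if i = j then 1 else 0)" for i
      by (simp add: l2_nth_damp[OF L] b(2)[OF j] basis_vec_def abs_minus_commute)
    then have "(cmod (l2_nth (damp L l (l2_op a (b j))) i))\<^sup>2 = (if i = j then (exp (- \<bar>real_of_int (l - j)\<bar> / L))\<^sup>2 else 0)" for i
      by simp
    then show "L2_set (\<lambda>i. cmod (l2_nth (damp L l (l2_op a (b j))) i)) F \<le> exp (- \<bar>real_of_int (l - j)\<bar> / L)"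
      using F by (simp add: L2_set_def)
  qed
  have step: "norm (damp L l (b j)) \<le> f (l - j) + (\<Sum>\<^sub>\<infinity>m. q m * norm (damp L (l - m) (b j)))"
    if j: "j \<in> J" for l j
  proof -
    let ?s = "\<Sum>\<^sub>\<infinity>m. d m * min 1 (\<bar>real_of_int m\<bar> / L) * norm (damp L (l - m) (b j))"
    let ?n = "norm (damp L l (b j))"
    have "c * ?n \<le> norm (l2_op a (damp L l (b j)))"
      by (rule below[OF S[OF L b(1)[OF j]]])
    also have "\<dots> \<le> norm (damp L l (l2_op a (b j))) + norm (l2_op a (damp L l (b j)) - damp L l (l2_op a (b j)))"
      by (rule norm_triangle_sub)
    also have "\<dots> \<le> exp (- \<bar>real_of_int (l - j)\<bar> / L) + (c / 4 * ?n + ?s)"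
      by (intro add_mono order_trans[OF norm_commutator_damp_l2_op_le[OF L \<epsilon>]] norm_damp_basis[OF j]
          mult_right_mono \<epsilon>_le norm_ge_zero order_refl)
    \<comment> \<open>Absorption would even leave \<open>3 * c / 4\<close>; the weaker factor
      \<open>c / 2\<close> matches the \<open>2 / c\<close> in \<open>f\<close> and
      \<open>q\<close>.\<close>
    finally have "c * ?n / 2 \<le> exp (- \<bar>real_of_int (l - j)\<bar> / L) + ?s"
      using mult_nonneg_nonneg[OF less_imp_le[OF c], of ?n] by simp
    then have "?n \<le> 2 / c * (exp (- \<bar>real_of_int (l - j)\<bar> / L) + ?s)"
      using c by (simp add: field_simps)
    also have "\<dots> = f (l - j) + 2 / c * ?s"
      by (simp add: f_def distrib_left)
    also have "2 / c * ?s = (\<Sum>\<^sub>\<infinity>m. q m * norm (damp L (l - m) (b j)))"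
      unfolding q_def infsum_cmult_right'[symmetric] by (simp only: mult.assoc)
    finally show ?thesis .
  qed
  have norm_b: "norm (b j) \<le> 1 / c" if j: "j \<in> J" for j
  proof -
    have "norm (l2_op a (b j)) \<le> 1"
    proof (rule norm_l2_leI)
      fix F :: "int set" assume "finite F"
      moreover have "(cmod (basis_vec j i))\<^sup>2 = (if i = j then 1 else 0)" for i
        by (simp add: basis_vec_def)
      ultimately show "L2_set (\<lambda>i. cmod (l2_nth (l2_op a (b j)) i)) F \<le> 1"
        by (simp add: L2_set_def b(2)[OF j])
    qed
    with below[OF b(1)[OF j]] have "c * norm (b j) \<le> 1" by linarith
    then show ?thesis using c by (simp add: field_simps)
  qed
  \<comment> \<open>This a priori bound makes the suprema in \<open>G\<close> meaningful and is the
    constant required by the convolution lemma.\<close>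
  have bdd: "norm (damp L l (b j)) \<le> 1 / c" if j: "j \<in> J" for l j
    using norm_damp_le[OF L] norm_b[OF j] order_trans by blast
  have G_upper: "norm (damp L (j + k) (b j)) \<le> G k" if j: "j \<in> J" for j k
    using j unfolding G_def by (auto intro!: cSUP_upper bdd_aboveI2[of _ _ "1/c"] bdd)
  have G0: "0 \<le> G k" for k
  proof (cases "J = {}")
    case False
    then obtain j where j: "j \<in> J" by blast
    show ?thesis by (rule order_trans[OF norm_ge_zero G_upper[OF j]])
  qed (simp add: G_def)
  have GC: "G k \<le> 1 / c" for k
    unfolding G_def using c by (auto intro!: cSUP_least bdd)
  have sqG: "(\<lambda>m. q m * G (k - m)) summable_on UNIV" for k
    by (rule summable_on_comparison_test[OF summable_on_cmult_left[OF q(1), of "1/c"]])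
      (use q(2) G0 GC in \<open>auto intro!: mult_left_mono mult_nonneg_nonneg simp del: times_divide_eq_right\<close>)
  have "G k \<le> f k + (\<Sum>\<^sub>\<infinity>m. q m * G (k - m))" for k
  proof (cases "J = {}")
    case True
    then show ?thesis using f(2) by (simp add: G_def)
  next
    case False
    \<comment> \<open>The centre \<open>j + k - m\<close> has offset \<open>k - m\<close> from
      \<open>j\<close>. Replacing each norm in the convolution by \<open>G (k - m)\<close> frees the
      right-hand side of \<open>j\<close>, and the supremum can be taken.\<close>
    have "norm (damp L (j + k) (b j)) \<le> f k + (\<Sum>\<^sub>\<infinity>m. q m * G (k - m))" if j: "j \<in> J" for j
    proof -
      have le: "q m * norm (damp L (j + k - m) (b j)) \<le> q m * G (k - m)" for m
        using G_upper[OF j, of "k - m"] q(2) by (intro mult_left_mono) (simp_all add: add_diff_eq)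
      have "(\<lambda>m. q m * norm (damp L (j + k - m) (b j))) summable_on UNIV"
        by (rule summable_on_comparison_test[OF sqG]) (use le q(2) in auto)
      then have "(\<Sum>\<^sub>\<infinity>m. q m * norm (damp L (j + k - m) (b j))) \<le> (\<Sum>\<^sub>\<infinity>m. q m * G (k - m))"
        using le by (intro infsum_mono sqG) auto
      then show ?thesis
        using step[OF j, of "j + k"] by simp
    qed
    then show ?thesis
      using False unfolding G_def by (auto intro: cSUP_least)
  qed
  note sums = sums_bounded_if_dominated_by_convolution[OF f q G0 GC this]
  show thesis
  proof
    show "G summable_on UNIV"
      using sums G0 by (intro nonneg_bdd_above_summable_on) (auto intro!: bdd_aboveI2)
    show "cmod (l2_nth (b j) i) \<le> G (i - j)" if j: "j \<in> J" for i j
    proof -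
      \<comment> \<open>The weight equals 1 at its centre, so damping around \<open>i\<close> keeps
        coordinate \<open>i\<close>.\<close>
      have "cmod (l2_nth (b j) i) = cmod (l2_nth (damp L i (b j)) i)"
        by (simp add: l2_nth_damp[OF L])
      also have "\<dots> \<le> norm (damp L i (b j))"
        by (rule cmod_l2_nth_le)
      also have "\<dots> \<le> G (i - j)"
        using G_upper[OF j, of "i - j"] by simp
      finally show ?thesis .
    qed
  qed
qed

section \<open>Inverses of matrices in the Wiener algebra\<close>

lemma ell2_subset_UNIV: "x \<in> ell2 I \<Longrightarrow> x \<in> ell2 UNIV"
  using ell2_iff by blast

lemma closed_l2_supported: "closed {x. \<forall>i. i \<notin> I \<longrightarrow> l2_nth x i = 0}"
  by (intro closed_Collect_all closed_Collect_imp closed_Collect_eq open_Collect_const continuous_on_const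
      linear_continuous_on bounded_linear_l2_nth)

lemma wiener_dominated:
  assumes "A \<in> wiener I"
  shows "dominated_matrix (\<lambda>i j. if i \<in> I \<and> j \<in> I then A i j else 0) (\<lambda>k. enn2real (diag_sup I A k))"
proof
  have fin: "wiener_norm I A < \<infinity>"
    using assms by (simp add: wiener_def)
  have sum_le: "sum (diag_sup I A) F \<le> wiener_norm I A" if "finite F" for F
    unfolding wiener_norm_def using that by (subst nonneg_infsum_complete) (auto intro: SUP_upper)
  \<comment> \<open>Finiteness of each diagonal supremum ensures that \<open>enn2real\<close> loses
    nothing.\<close>
  have d_fin: "diag_sup I A k < \<infinity>" for k
    using sum_le[of "{k}"] fin by auto
  show "(\<lambda>k. enn2real (diag_sup I A k)) summable_on UNIV"
  proof (rule nonneg_bdd_above_summable_on)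
    show "bdd_above (sum (\<lambda>k. enn2real (diag_sup I A k)) ` {F. F \<subseteq> UNIV \<and> finite F})"
    proof (rule bdd_aboveI2)
      fix F :: "int set" assume F: "F \<in> {F. F \<subseteq> UNIV \<and> finite F}"
      have "ennreal (\<Sum>k\<in>F. enn2real (diag_sup I A k)) = sum (diag_sup I A) F"
        using d_fin by (subst sum_ennreal[symmetric]) auto
      also have "\<dots> \<le> ennreal (enn2real (wiener_norm I A))"
        using sum_le F fin by simp
      finally show "(\<Sum>k\<in>F. enn2real (diag_sup I A k)) \<le> enn2real (wiener_norm I A)"
        by (simp add: ennreal_le_iff)
    qed
  qed simp
  show "cmod (if i \<in> I \<and> j \<in> I then A i j else 0) \<le> enn2real (diag_sup I A (i - j))" for i j
  proof (cases "i \<in> I \<and> j \<in> I")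
    case True
    then have "ennreal (cmod (A i j)) \<le> diag_sup I A (i - j)"
      unfolding diag_sup_def by (intro SUP_upper2[of "(i, j)"]) auto
    also have "\<dots> = ennreal (enn2real (diag_sup I A (i - j)))"
      using d_fin by simp
    finally show ?thesis
      using True by (simp add: ennreal_le_iff)
  qed auto
qed

lemma wiener_if_dominated:
  assumes G: "G summable_on UNIV" and le: "\<And>i j. i \<in> I \<Longrightarrow> j \<in> I \<Longrightarrow> cmod (B i j) \<le> G (i - j)"
  shows "B \<in> wiener I"
proof -
  \<comment> \<open>\<open>G\<close> may be negative on diagonals that contain no entry over
    \<open>I\<close>; the absolute value makes the passage to \<open>ennreal\<close>
    faithful.\<close>
  define g where "g k = \<bar>G k\<bar>" for k
  have g: "g summable_on UNIV"
    using iffD1[OF summable_on_iff_abs_summable_on_real G] by (simp add: g_def[abs_def])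
  have g0: "0 \<le> g k" for k by (simp add: g_def)
  have diag_le: "diag_sup I B k \<le> ennreal (g k)" for k
    unfolding diag_sup_def
  proof (rule SUP_least, clarify)
    fix i j assume "i \<in> I" "j \<in> I" "k = i - j"
    then show "ennreal (cmod (B i j)) \<le> ennreal (g (i - j))"
      using le[of i j] by (intro ennreal_leI) (simp add: g_def)
  qed
  have sum_le: "sum (diag_sup I B) F \<le> ennreal (infsum g UNIV)" if F: "finite F" for F
  proof -
    have "sum (diag_sup I B) F \<le> (\<Sum>k\<in>F. ennreal (g k))"
      by (intro sum_mono diag_le)
    also have "\<dots> = ennreal (sum g F)"
      using g0 by simp
    also have "\<dots> \<le> ennreal (infsum g UNIV)"
      using F g g0 by (intro ennreal_leI finite_sum_le_infsum) auto
    finally show ?thesis .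
  qed
  have "wiener_norm I B \<le> ennreal (infsum g UNIV)"
    unfolding wiener_norm_def
  proof (rule infsum_le_finite_sums)
    show "diag_sup I B summable_on UNIV"
      by (rule nonneg_summable_on_complete) simp
  qed (rule sum_le)
  then show ?thesis
    by (simp add: wiener_def order_le_less_trans)
qed

lemma l2_nth_l2_op_eq_mat_op:
  assumes "dominated_matrix (\<lambda>i j. if i \<in> I \<and> j \<in> I then A i j else 0) d" (is "dominated_matrix ?a d")
  shows "l2_nth (l2_op ?a x) = mat_op I A (l2_nth x)"
proof
  interpret dominated_matrix ?a d by fact
  fix i
  have "(\<Sum>\<^sub>\<infinity>j. ?a i j * l2_nth x j) = (\<Sum>\<^sub>\<infinity>j\<in>I. A i j * l2_nth x j)" if "i \<in> I"
    using that by (intro infsum_cong_neutral) auto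
  then show "l2_nth (l2_op ?a x) i = mat_op I A (l2_nth x) i"
    by (simp add: l2_nth_l2_op mat_op_def)
qed

lemma basis_vec_ell2: "j \<in> I \<Longrightarrow> basis_vec j \<in> ell2 I"
proof -
  assume "j \<in> I"
  moreover have "finite {i \<in> I. (cmod (basis_vec j i))\<^sup>2 \<noteq> 0}"
    by (rule finite_subset[of _ "{j}"]) (auto simp: basis_vec_def split: if_splits)
  ultimately show ?thesis
    unfolding ell2_def using finite_nonzero_values_imp_summable_on[of I "\<lambda>i. (cmod (basis_vec j i))\<^sup>2"]
    by (auto simp: basis_vec_def)
qed

lift_definition l2_basis :: "int \<Rightarrow> l2" is basis_vec
  by (rule basis_vec_ell2) simp

text \<open>The class instance provides real scalars only, whereas expansions in the standard basis
  have complex coefficients.\<close>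

lift_definition scaleC_l2 :: "complex \<Rightarrow> l2 \<Rightarrow> l2" is "\<lambda>c x i. c * x i"
  by (rule ell2_scale)

lemma (in dominated_matrix) l2_op_scaleC: "l2_op a (scaleC_l2 c x) = scaleC_l2 c (l2_op a x)"
proof (rule l2_eqI)
  fix i
  have "(\<Sum>\<^sub>\<infinity>j. a i j * (c * l2_nth x j)) = (\<Sum>\<^sub>\<infinity>j. c * (a i j * l2_nth x j))"
    by (simp only: mult.left_commute)
  also have "\<dots> = c * (\<Sum>\<^sub>\<infinity>j. a i j * l2_nth x j)"
    by (rule infsum_cmult_right')
  finally show "l2_nth (l2_op a (scaleC_l2 c x)) i = l2_nth (scaleC_l2 c (l2_op a x)) i"
    by (simp add: l2_nth_l2_op scaleC_l2.rep_eq)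
qed

text \<open>The squared distance from \<open>x\<close> to a partial sum is the part of the square
  sum outside \<open>F\<close>, which tends to 0 along the finite subsets of
  \<open>I\<close>.\<close>

lemma has_sum_l2_basis:
  assumes "l2_nth x \<in> ell2 I"
  shows "((\<lambda>j. scaleC_l2 (l2_nth x j) (l2_basis j)) has_sum x) I"
proof -
  let ?P = "\<lambda>F. \<Sum>j\<in>F. scaleC_l2 (l2_nth x j) (l2_basis j)"
  let ?g = "\<lambda>i. (cmod (l2_nth x i))\<^sup>2"
  have g: "?g summable_on I" and out: "\<And>i. i \<notin> I \<Longrightarrow> l2_nth x i = 0"
    using assms by (auto simp: ell2_def)
  have norm_tail: "norm (?P F - x) = sqrt (infsum ?g I - sum ?g F)" if F: "finite F" "F \<subseteq> I" for F
  proof -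
    have P: "l2_nth (?P F) i = (if i \<in> F then l2_nth x i else 0)" for i
      using F(1) by (simp add: linear_sum[OF bounded_linear.linear[OF bounded_linear_l2_nth]] scaleC_l2.rep_eq
          l2_basis.rep_eq basis_vec_def if_distrib cong: if_cong)
    have "norm (?P F - x) = sqrt (\<Sum>\<^sub>\<infinity>i. (cmod (l2_nth (?P F - x) i))\<^sup>2)"
      by (rule norm_l2.rep_eq)
    also have "(\<Sum>\<^sub>\<infinity>i. (cmod (l2_nth (?P F - x) i))\<^sup>2) = infsum ?g (I - F)"
      using out by (intro infsum_cong_neutral) (auto simp: minus_l2.rep_eq P)
    also have "\<dots> = infsum ?g I - sum ?g F"
      using F g by (simp add: infsum_Diff)
    finally show ?thesis .
  qed
  have "(sum ?g \<longlongrightarrow> infsum ?g I) (finite_subsets_at_top I)"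
    by (rule infsum_tendsto[OF g])
  then have "((\<lambda>F. sqrt (infsum ?g I - sum ?g F)) \<longlongrightarrow> sqrt (infsum ?g I - infsum ?g I)) (finite_subsets_at_top I)"
    by (intro tendsto_intros)
  then have "((\<lambda>F. sqrt (infsum ?g I - sum ?g F)) \<longlongrightarrow> 0) (finite_subsets_at_top I)"
    by simp
  then have "((\<lambda>F. norm (?P F - x)) \<longlongrightarrow> 0) (finite_subsets_at_top I)"
  proof (rule Lim_transform_eventually)
    show "\<forall>\<^sub>F F in finite_subsets_at_top I. sqrt (infsum ?g I - sum ?g F) = norm (?P F - x)"
      by (rule eventually_finite_subsets_at_top_weakI) (simp only: norm_tail)
  qed
  then show ?thesis
    unfolding has_sum_def by (simp only: tendsto_norm_zero_iff LIM_zero_iff)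
qed

text \<open>The first conjunct follows from the decay of the columns. The second, that the inverse
  acts through its matrix, follows by expanding \<open>y\<close> in the standard basis and using the
  lower bound as continuity of the inverse.\<close>

theorem theorem3p1:
  fixes I :: "int set" and A :: "int \<Rightarrow> int \<Rightarrow> complex"
  assumes "I = \<nat> \<or> I = \<int>"
    and "A \<in> wiener I"
    and "invertible_on_ell2 I A"
  shows "matrix_of_op (inverse_op I A) \<in> wiener I \<and>
         (\<forall>y\<in>ell2 I. mat_op I (matrix_of_op (inverse_op I A)) y = inverse_op I A y)"
proof -
  define a where "a = (\<lambda>i j. if i \<in> I \<and> j \<in> I then A i j else 0)"
  define d where "d k = enn2real (diag_sup I A k)" for k
  have dom: "dominated_matrix a d"
    using wiener_dominated[OF assms(2)] by (simp add: a_def d_def[abs_def])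
  interpret dominated_matrix a d by (rule dom)
  \<comment> \<open>The extended matrix annihilates every vector supported outside \<open>I\<close>,
    so bijectivity and the lower bound are sought on this subspace.\<close>
  define S where "S = {x. \<forall>i. i \<notin> I \<longrightarrow> l2_nth x i = 0}"
  have S_iff: "x \<in> S \<longleftrightarrow> l2_nth x \<in> ell2 I" for x
    unfolding S_def using ell2_iff[of "l2_nth x" I] l2_nth[of x] by blast
  have subS: "subspace S"
    unfolding S_def by (auto simp: subspace_def zero_l2.rep_eq plus_l2.rep_eq scaleR_l2.rep_eq)
  have closedS: "closed S"
    unfolding S_def by (rule closed_l2_supported)
  have op: "l2_nth (l2_op a x) = mat_op I A (l2_nth x)" for x
    using l2_nth_l2_op_eq_mat_op[of I A d x] dom by (simp add: a_def)
  have bij: "bij_betw (mat_op I A) (ell2 I) (ell2 I)"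
    using assms(3) by (simp add: invertible_on_ell2_def)
  have bij_nth: "bij_betw l2_nth S (ell2 I)"
    by (rule bij_betw_byWitness[of _ Abs_l2])
      (auto simp: S_iff l2_nth_inverse Abs_l2_inverse ell2_subset_UNIV)
  \<comment> \<open>\<open>l2_nth\<close> is a bijection from \<open>S\<close> to
    \<open>ell2 I\<close> that intertwines \<open>l2_op a\<close> with
    \<open>mat_op I A\<close>.\<close>
  have "bij_betw (l2_op a) S S"
  proof -
    have "bij_betw (mat_op I A \<circ> l2_nth) S (ell2 I)"
      by (rule bij_betw_trans[OF bij_nth bij])
    then have "bij_betw (l2_nth \<circ> l2_op a) S (ell2 I)"
      by (simp add: o_def op)
    moreover have "(l2_op a) ` S \<subseteq> S"
      using calculation by (auto simp: S_iff bij_betw_def)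
    ultimately show ?thesis
      using bij_betw_comp_iff2[OF bij_nth] by blast
  qed
  then obtain c where c: "c > 0" and below: "\<And>x. x \<in> S \<Longrightarrow> c * norm x \<le> norm (l2_op a x)"
    using bounded_below_if_bij_betw_closed_subspaces[OF bounded_linear_l2_op subS closedS subS closedS] by blast
  define B where "B = inverse_op I A"
  have B: "B y \<in> ell2 I" "mat_op I A (B y) = y" if "y \<in> ell2 I" for y
    using that bij_betw_inv_into[OF bij] bij_betw_inv_into_right[OF bij]
    unfolding B_def inverse_op_def by (auto dest: bij_betwE)
  define R where "R y = Abs_l2 (B y)" for y
  have R: "R y \<in> S" "l2_nth (R y) = B y" "l2_nth (l2_op a (R y)) = y" if "y \<in> ell2 I" for y
    using B[OF that] by (simp_all add: R_def S_iff op Abs_l2_inverse ell2_subset_UNIV)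
  obtain G where G: "G summable_on UNIV" "\<And>i j. j \<in> I \<Longrightarrow> cmod (l2_nth (R (basis_vec j)) i) \<le> G (i - j)"
  proof (rule columns_of_inverse_off_diagonal_decay[of c S I "\<lambda>j. R (basis_vec j)"])
    show "damp L l x \<in> S" if "L > 0" "x \<in> S" for L l x
      using that by (simp add: S_def l2_nth_damp)
  qed (use c below R basis_vec_ell2 in auto)
  have "matrix_of_op B \<in> wiener I"
    by (rule wiener_if_dominated[OF G(1)]) (use G(2) R(2) basis_vec_ell2 in \<open>simp add: matrix_of_op_def\<close>)
  moreover have "mat_op I (matrix_of_op B) y = B y" if y: "y \<in> ell2 I" for y
  proof -
    let ?Y = "Abs_l2 y"
    let ?f = "\<lambda>j. scaleC_l2 (y j) (R (basis_vec j))"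
    let ?g = "\<lambda>j. scaleC_l2 (y j) (l2_basis j)"
    have Y: "l2_nth ?Y = y"
      using y by (simp add: Abs_l2_inverse ell2_subset_UNIV)
    have RY: "l2_op a (R y) = ?Y"
      by (rule l2_eqI) (simp add: R y Y)
    have Re: "l2_op a (R (basis_vec j)) = l2_basis j" if "j \<in> I" for j
      by (rule l2_eqI) (simp add: R basis_vec_ell2 that l2_basis.rep_eq)
    have "(sum ?g \<longlongrightarrow> ?Y) (finite_subsets_at_top I)"
      using has_sum_l2_basis[of ?Y I] y by (simp add: Y has_sum_def)
    then have "((\<lambda>F. norm (sum ?g F - ?Y) / c) \<longlongrightarrow> 0) (finite_subsets_at_top I)"
      by (intro tendsto_divide_zero tendsto_norm_zero LIM_zero)
    \<comment> \<open>Convergence is pulled back through \<open>l2_op a\<close>: it maps this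
      difference to the error of the basis expansion of \<open>y\<close>, and the lower bound on
      \<open>S\<close> controls the difference by that error.\<close>
    then have "((\<lambda>F. sum ?f F - R y) \<longlongrightarrow> 0) (finite_subsets_at_top I)"
    proof (rule Lim_null_comparison[rotated])
      have "norm (sum ?f F - R y) \<le> norm (sum ?g F - ?Y) / c" if F: "finite F" "F \<subseteq> I" for F
      proof -
        have "sum ?f F - R y \<in> S"
          using F R y basis_vec_ell2 subS
          by (intro subspace_diff subspace_sum) (auto simp: S_def scaleC_l2.rep_eq)
        moreover have "l2_op a (sum ?f F - R y) = sum ?g F - ?Y"
          using F by (auto simp: linear_diff[OF bounded_linear.linear[OF bounded_linear_l2_op]]
              linear_sum[OF bounded_linear.linear[OF bounded_linear_l2_op]] l2_op_scaleC RY Re intro!: sum.cong)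
        ultimately show ?thesis
          using below[of "sum ?f F - R y"] c by (simp only: pos_le_divide_eq mult.commute)
      qed
      then show "\<forall>\<^sub>F F in finite_subsets_at_top I. norm (sum ?f F - R y) \<le> norm (sum ?g F - ?Y) / c"
        by (intro eventually_finite_subsets_at_top_weakI)
    qed
    then have hs: "(?f has_sum R y) I"
      unfolding has_sum_def by (rule LIM_zero_cancel)
    have nth: "((\<lambda>j. y j * B (basis_vec j) i) has_sum B y i) I" for i
    proof -
      have "((\<lambda>j. y j * l2_nth (R (basis_vec j)) i) has_sum B y i) I"
        using has_sum_bounded_linear[OF bounded_linear_l2_nth[of i] hs] R(2)[OF y]
        by (simp add: scaleC_l2.rep_eq)
      then show ?thesis
        by (rule iffD1[OF has_sum_cong, rotated]) (simp add: R(2) basis_vec_ell2)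
    qed
    show ?thesis
    proof
      fix i
      show "mat_op I (matrix_of_op B) y i = B y i"
      proof (cases "i \<in> I")
        case True
        then show ?thesis
          using infsumI[OF nth[of i]] by (simp add: mat_op_def matrix_of_op_def mult.commute)
      next
        case False
        then show ?thesis
          using B(1)[OF y] by (simp add: mat_op_def ell2_def)
      qed
    qed
  qed
  ultimately show ?thesis by (simp add: B_def)
qed

end
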